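(* For $n$ voters, the number of proper linear games having exactly one shift-minimal winning coalition is $2^n-\binom{n}{\lfloor n/2\rfloor}$. Moreover, for a coalition $A\subseteq N=\{1,\dots,n\}$, the linear game $\langle A\rangle$ is proper if and only if there is some $k\le n$ such that $A$ contains $k$ of the $2k-1$ largest elements of $N$.
   Context: A simple game on $N=\{1,\dots,n\}$ is a family $W$ of subsets of $N$ (winning coalitions) with $N\in W$, $\emptyset\notin W$, closed under supersets. Order subsets of $N$ by: for $A=\{a_1>\dots>a_k\}$, $B=\{b_1>\dots>b_j\}$, $B\ge A$ iff $k\le j$ and $b_i\ge a_i$ for $i\le k$. A linear game is a simple game whose winning set is an up-set for this order; its shift-minimal winning coalitions are the minimal elements of its winning set. For a coalition $A$, $\langle A\rangle$ denotes the linear game whose winning coalitions are all $B$ with $B\ge A$. A game is proper if no coalition and its complement are both winning. *)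

theory Defs
  imports Main
begin

definition voters :: "nat \<Rightarrow> nat set" where
  "voters n = {1..n}"

definition simple_game :: "nat \<Rightarrow> nat set set \<Rightarrow> bool" where
  "simple_game n W \<longleftrightarrow>
     W \<subseteq> Pow (voters n) \<and> voters n \<in> W \<and> {} \<notin> W \<and>
     (\<forall>A\<in>W. \<forall>B. A \<subseteq> B \<and> B \<subseteq> voters n \<longrightarrow> B \<in> W)"

definition decreasing_list :: "nat set \<Rightarrow> nat list" where
  "decreasing_list A = rev (sorted_list_of_set A)"

text \<open>Intended for finite sets only: \<^const>\<open>sorted_list_of_set\<close> is empty on infinite ones.\<close>

definition shift_le :: "nat set \<Rightarrow> nat set \<Rightarrow> bool"  (infix "\<preceq>" 50) where
  "A \<preceq> B \<longleftrightarrow>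
     length (decreasing_list A) \<le> length (decreasing_list B) \<and>
     (\<forall>i < length (decreasing_list A). decreasing_list A ! i \<le> decreasing_list B ! i)"

definition linear_game :: "nat \<Rightarrow> nat set set \<Rightarrow> bool" where
  "linear_game n W \<longleftrightarrow>
     simple_game n W \<and> (\<forall>A\<in>W. \<forall>B. B \<subseteq> voters n \<and> A \<preceq> B \<longrightarrow> B \<in> W)"

definition shift_minimal_winning :: "nat set set \<Rightarrow> nat set set" where
  "shift_minimal_winning W = {A \<in> W. \<not> (\<exists>B\<in>W. B \<noteq> A \<and> B \<preceq> A)}"

definition generated_game :: "nat \<Rightarrow> nat set \<Rightarrow> nat set set" where
  "generated_game n A = {B. B \<subseteq> voters n \<and> A \<preceq> B}"

definition proper_game :: "nat \<Rightarrow> nat set set \<Rightarrow> bool" where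
  "proper_game n W \<longleftrightarrow> \<not> (\<exists>A. A \<subseteq> voters n \<and> A \<in> W \<and> voters n - A \<in> W)"

text \<open>All of \<open>voters n\<close> when \<open>m \<ge> n\<close>.\<close>

definition largest_voters :: "nat \<Rightarrow> nat \<Rightarrow> nat set" where
  "largest_voters n m = {i \<in> voters n. card {j \<in> voters n. i < j} < m}"

lemma length_decreasing_list [simp]: "length (decreasing_list A) = card A"
  by (simp add: decreasing_list_def)

lemma shift_le_trans: "A \<preceq> B \<Longrightarrow> B \<preceq> C \<Longrightarrow> A \<preceq> C"
  unfolding shift_le_def using le_trans less_le_trans by metis

text \<open>The \<open>i\<close>-th largest element of \<open>A\<close> is at least \<open>x\<close> iff more than \<open>i\<close> elements are.\<close>

lemma nth_decreasing_list_ge_iff: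
  assumes "finite A" "i < card A"
  shows "x \<le> decreasing_list A ! i \<longleftrightarrow> i < card {a \<in> A. x \<le> a}"
proof -
  define xs where "xs = decreasing_list A"
  have len: "length xs = card A" and dist: "distinct xs" and set: "set xs = A"
    using assms by (simp_all add: xs_def) (simp_all add: decreasing_list_def)
  have dec: "xs ! l \<le> xs ! k" if "k \<le> l" "l < length xs" for k l
    using that unfolding xs_def decreasing_list_def by (simp add: sorted_rev_nth_mono)
  have inj: "inj_on ((!) xs) K" if "K \<subseteq> {..<length xs}" for K
    using dist that by (simp add: inj_on_nth subset_eq)
  show ?thesis
  proof
    assume x: "x \<le> decreasing_list A ! i"
    have "(!) xs ` {..i} \<subseteq> {a \<in> A. x \<le> a}"
    proof safe
      fix k assume "k \<le> i"
      then show "xs ! k \<in> A" "x \<le> xs ! k"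
        using x dec[of k i] assms(2) len set nth_mem[of k xs] unfolding xs_def[symmetric] by auto
    qed
    then have "card ((!) xs ` {..i}) \<le> card {a \<in> A. x \<le> a}"
      using assms(1) by (intro card_mono) auto
    moreover have "card ((!) xs ` {..i}) = Suc i"
      using assms(2) len by (subst card_image) (auto intro!: inj)
    ultimately show "i < card {a \<in> A. x \<le> a}" by simp
  next
    assume i: "i < card {a \<in> A. x \<le> a}"
    show "x \<le> decreasing_list A ! i"
    proof (rule ccontr)
      assume n: "\<not> x \<le> decreasing_list A ! i"
      have "{a \<in> A. x \<le> a} \<subseteq> (!) xs ` {..<i}"
      proof
        fix a assume a: "a \<in> {a \<in> A. x \<le> a}"
        then obtain k where k: "k < length xs" "a = xs ! k"
          using set by (auto simp: in_set_conv_nth)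
        have "k < i"
          using dec[of i k] k a n unfolding xs_def[symmetric] by (cases "i \<le> k") auto
        then show "a \<in> (!) xs ` {..<i}" using k by auto
      qed
      then have "card {a \<in> A. x \<le> a} \<le> card ((!) xs ` {..<i})"
        by (intro card_mono) auto
      also have "\<dots> \<le> i" using card_image_le[of "{..<i}" "(!) xs"] by simp
      finally show False using i by simp
    qed
  qed
qed

lemma subset_imp_shift_le:
  assumes "finite B" "A \<subseteq> B"
  shows "A \<preceq> B"
proof -
  have fin: "finite A" and card: "card A \<le> card B"
    using assms finite_subset card_mono by auto
  have "decreasing_list A ! i \<le> decreasing_list B ! i" if i: "i < card A" for i
  proof -
    let ?x = "decreasing_list A ! i"
    have "i < card {a \<in> A. ?x \<le> a}"
      using nth_decreasing_list_ge_iff[OF fin i, of ?x] by simp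
    also have "\<dots> \<le> card {a \<in> B. ?x \<le> a}"
      using assms by (intro card_mono) auto
    finally show ?thesis
      using nth_decreasing_list_ge_iff[OF assms(1), of i ?x] i card by simp
  qed
  then show ?thesis using card by (simp add: shift_le_def)
qed

lemma linear_game_generated_game:
  assumes "A \<subseteq> voters n" "A \<noteq> {}"
  shows "linear_game n (generated_game n A)"
proof -
  have fin: "finite (voters n)" by (simp add: voters_def)
  then have "\<not> A \<preceq> {}"
    using assms finite_subset[OF assms(1)] by (auto simp: shift_le_def)
  moreover have "B \<preceq> C" if "B \<subseteq> C" "C \<subseteq> voters n" for B C
    using that fin finite_subset subset_imp_shift_le by blast
  ultimately show ?thesis
    using assms unfolding linear_game_def simple_game_def generated_game_def
    by (smt (verit, ccfv_SIG) CollectD CollectI Pow_iff order_refl shift_le_trans subsetI)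
qed

end

theory Submission imports Defs begin

text \<open>
  For finite sets, \<open>A \<preceq> B\<close> says that every final segment contains at least as many elements
  of \<open>B\<close> as of \<open>A\<close>. If \<open>B\<close> and its complement both dominate \<open>A\<close>, then \<open>A\<close> fills at most half
  of each final segment of \<open>{1..n}\<close>; conversely, the alternating coalition \<open>{n, n - 2, \<dots>}\<close> and its
  complement both dominate every such \<open>A\<close>. So \<open>\<langle>A\<rangle>\<close> is improper exactly for these \<open>A\<close>,
  which are ballot sequences. Ballot sequences with \<open>k\<close> marked positions number
  \<open>(n choose k) - (n choose (k - 1))\<close> for \<open>k \<le> n / 2\<close>, which telescopes to the central binomial
  coefficient. Finally, a linear game with a unique shift-minimal winning coalition \<open>A\<close> is \<open>\<langle>A\<rangle>\<close>.
\<close>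

section \<open>The shift order in terms of final segments\<close>

lemma finite_voters [simp]: "finite (voters n)"
  by (simp add: voters_def)

text \<open>The entry of index \<open>i\<close> is at least \<open>x\<close> exactly when more than
  \<open>i\<close> elements are, which turns entrywise comparison into comparison of counts.
  Conversely, \<open>x\<close> is taken to be an entry of the list of \<open>A\<close>, and
  \<open>x = 0\<close> compares the sizes.\<close>

lemma shift_le_iff_card_ge:
  assumes "finite A" "finite B"
  shows "A \<preceq> B \<longleftrightarrow> (\<forall>x. card {a \<in> A. x \<le> a} \<le> card {b \<in> B. x \<le> b})"
proof
  assume le: "A \<preceq> B"
  show "\<forall>x. card {a \<in> A. x \<le> a} \<le> card {b \<in> B. x \<le> b}"
  proof
    fix x
    show "card {a \<in> A. x \<le> a} \<le> card {b \<in> B. x \<le> b}"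
    proof (cases "card {a \<in> A. x \<le> a}")
      case (Suc i)
      have "card {a \<in> A. x \<le> a} \<le> card A"
        using assms by (intro card_mono) auto
      then have i: "i < card A" "i < card B"
        using Suc le by (auto simp: shift_le_def)
      have "x \<le> decreasing_list A ! i"
        using nth_decreasing_list_ge_iff[OF assms(1) i(1)] Suc by simp
      also have "\<dots> \<le> decreasing_list B ! i"
        using le i(1) by (simp add: shift_le_def)
      finally show ?thesis
        using nth_decreasing_list_ge_iff[OF assms(2) i(2)] Suc by simp
    qed simp
  qed
next
  assume le: "\<forall>x. card {a \<in> A. x \<le> a} \<le> card {b \<in> B. x \<le> b}"
  then have card: "card A \<le> card B"
    by (auto dest: spec[of _ 0])
  have "decreasing_list A ! i \<le> decreasing_list B ! i" if i: "i < card A" for i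
  proof -
    have "i < card {a \<in> A. decreasing_list A ! i \<le> a}"
      using nth_decreasing_list_ge_iff[OF assms(1) i, of "decreasing_list A ! i"] by simp
    also have "\<dots> \<le> card {b \<in> B. decreasing_list A ! i \<le> b}"
      using le by simp
    finally show ?thesis
      using nth_decreasing_list_ge_iff[OF assms(2)] i card by simp
  qed
  then show "A \<preceq> B"
    using card by (simp add: shift_le_def)
qed

lemma shift_le_refl [simp]: "A \<preceq> A"
  by (simp add: shift_le_def)

lemma shift_le_antisym:
  assumes "finite A" "finite B" "A \<preceq> B" "B \<preceq> A"
  shows "A = B"
proof -
  have "decreasing_list A = decreasing_list B"
    using assms(3,4) by (intro nth_equalityI) (auto simp: shift_le_def intro: order_antisym)
  then have "set (decreasing_list A) = set (decreasing_list B)"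
    by simp
  then show ?thesis
    using assms(1,2) by (simp add: decreasing_list_def)
qed

section \<open>Games with a single generator\<close>

text \<open>By transitivity, a minimal element of the finite set of winning coalitions below
  \<open>C\<close> is minimal in all of \<open>W\<close>.\<close>

lemma exists_shift_minimal_below:
  assumes "W \<subseteq> Pow (voters n)" "C \<in> W"
  obtains A where "A \<in> shift_minimal_winning W" "A \<preceq> C"
proof -
  have fin: "finite D" if "D \<in> W" for D
    using assms(1) that finite_subset[of D "voters n"] by auto
  have "\<exists>A\<in>{D\<in>W. D \<preceq> C}. \<forall>B\<in>{D\<in>W. D \<preceq> C}. B \<noteq> A \<longrightarrow> \<not> (B \<preceq> A \<and> B \<noteq> A)"
  proof (rule Finite_Set.bex_min_element)
    show "finite {D \<in> W. D \<preceq> C}"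
      using finite_subset[OF assms(1)] by simp
    show "asymp_on {D \<in> W. D \<preceq> C} (\<lambda>B A. B \<preceq> A \<and> B \<noteq> A)"
      using shift_le_antisym fin by (intro asymp_onI) blast
    show "transp_on {D \<in> W. D \<preceq> C} (\<lambda>B A. B \<preceq> A \<and> B \<noteq> A)"
    proof (rule transp_onI)
      fix B D E
      assume "B \<in> {D \<in> W. D \<preceq> C}" "D \<in> {D \<in> W. D \<preceq> C}"
        and BDE: "B \<preceq> D \<and> B \<noteq> D" "D \<preceq> E \<and> D \<noteq> E"
      then have "finite B" "finite D"
        using fin by auto
      then show "B \<preceq> E \<and> B \<noteq> E"
        using BDE shift_le_antisym shift_le_trans by metis
    qed
    show "{D \<in> W. D \<preceq> C} \<noteq> {}"
      using assms(2) by auto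
  qed
  then obtain A where "A \<in> W" "A \<preceq> C" "\<forall>B\<in>W. B \<preceq> C \<longrightarrow> \<not> (B \<preceq> A \<and> B \<noteq> A)"
    by auto
  then have "A \<in> shift_minimal_winning W"
    unfolding shift_minimal_winning_def using shift_le_trans by blast
  then show ?thesis
    using that \<open>A \<preceq> C\<close> by blast
qed

lemma shift_minimal_winning_generated_game:
  assumes "A \<subseteq> voters n"
  shows "shift_minimal_winning (generated_game n A) = {A}"
proof -
  have "B = A" if "B \<subseteq> voters n" "B \<preceq> A" "A \<preceq> B" for B
    using that assms by (intro shift_le_antisym) (auto intro: finite_subset[OF _ finite_voters])
  then show ?thesis
    using assms unfolding shift_minimal_winning_def generated_game_def
    by (intro set_eqI, simp) (metis shift_le_refl)
qed

text \<open>Every winning coalition has a shift-minimal one below it, so uniqueness puts all of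
  \<open>W\<close> above \<open>A\<close>; closure under the order gives the other inclusion. The
  generator \<open>{}\<close> is excluded because its game would let \<open>{}\<close> win.\<close>

lemma linear_game_unique_shift_minimal_iff:
  "linear_game n W \<and> (\<exists>!A. A \<in> shift_minimal_winning W) \<longleftrightarrow>
     W \<in> generated_game n ` (Pow (voters n) - {{}})"
proof
  assume L: "linear_game n W \<and> (\<exists>!A. A \<in> shift_minimal_winning W)"
  then have W: "W \<subseteq> Pow (voters n)" "{} \<notin> W"
    by (auto simp: linear_game_def simple_game_def)
  obtain A where A: "A \<in> shift_minimal_winning W"
    and unique: "\<And>B. B \<in> shift_minimal_winning W \<Longrightarrow> B = A"
    using L by auto
  have "A \<in> W"
    using A by (simp add: shift_minimal_winning_def)
  moreover have "W = generated_game n A"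
  proof
    show "W \<subseteq> generated_game n A"
    proof
      fix C assume C: "C \<in> W"
      then obtain B where "B \<in> shift_minimal_winning W" "B \<preceq> C"
        using exists_shift_minimal_below[OF W(1)] by blast
      then show "C \<in> generated_game n A"
        using C W(1) unique by (auto simp: generated_game_def)
    qed
    show "generated_game n A \<subseteq> W"
      using L \<open>A \<in> W\<close> by (auto simp: generated_game_def linear_game_def)
  qed
  ultimately show "W \<in> generated_game n ` (Pow (voters n) - {{}})"
    using W by auto
next
  assume "W \<in> generated_game n ` (Pow (voters n) - {{}})"
  then show "linear_game n W \<and> (\<exists>!A. A \<in> shift_minimal_winning W)"
    by (auto simp: shift_minimal_winning_generated_game intro!: linear_game_generated_game)
qed

text \<open>The generator is recovered from its game as the only shift-minimal winning
  coalition.\<close>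

lemma inj_on_generated_game: "inj_on (generated_game n) (Pow (voters n))"
  by (intro inj_onI) (metis PowD shift_minimal_winning_generated_game singleton_inject)

section \<open>Properness as a majority in some final segment\<close>

text \<open>Pairing off consecutive numbers from \<open>n\<close> downwards, each parity class
  contains one element of every pair. The values \<open>c = 0\<close> and \<open>c = 1\<close> give
  the alternating coalition and its complement.\<close>

lemma card_alternating_ge:
  assumes "c \<le> 1"
  shows "(n + 1 - x) div 2 \<le> card {a \<in> {x..n}. (n - a) mod 2 = c}"
proof -
  let ?f = "\<lambda>j. n - c - 2 * j"
  \<comment> \<open>The second equation says that the subtraction in \<open>?f\<close> is never
    truncated; it yields both the parity and the injectivity.\<close>
  have f: "x \<le> ?f j" "n - ?f j = c + 2 * j" if "j < (n + 1 - x) div 2" for j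
    using that assms by auto
  then have "?f ` {..<(n + 1 - x) div 2} \<subseteq> {a \<in> {x..n}. (n - a) mod 2 = c}"
    using assms by auto
  moreover have "inj_on ?f {..<(n + 1 - x) div 2}"
  proof (rule inj_onI)
    fix i j assume "i \<in> {..<(n + 1 - x) div 2}" "j \<in> {..<(n + 1 - x) div 2}" "?f i = ?f j"
    then show "i = j"
      using f(2)[of i] f(2)[of j] by simp
  qed
  ultimately show ?thesis
    using card_inj_on_le[of ?f "{..<(n + 1 - x) div 2}"] by simp
qed

text \<open>Without a majority segment, both parity classes dominate \<open>A\<close>, and they are
  complementary. With one, the counts of \<open>B\<close> and its complement add up to the size of
  that segment, so they cannot both reach the count of \<open>A\<close>.\<close>

lemma proper_generated_game_iff:
  assumes A: "A \<subseteq> voters n"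
  shows "proper_game n (generated_game n A) \<longleftrightarrow>
           (\<exists>x\<in>voters n. n + 1 - x < 2 * card {a \<in> A. x \<le> a})"
proof
  assume proper: "proper_game n (generated_game n A)"
  show "\<exists>x\<in>voters n. n + 1 - x < 2 * card {a \<in> A. x \<le> a}"
  proof (rule ccontr)
    assume "\<not> ?thesis"
    then have half: "card {a \<in> A. x \<le> a} \<le> (n + 1 - x) div 2" if "x \<in> voters n" for x
      using that by (auto simp: not_less)
    have dom: "A \<preceq> {a \<in> voters n. (n - a) mod 2 = c}" if c: "c \<le> 1" for c
    proof (subst shift_le_iff_card_ge)
      show "finite A"
        using A finite_subset finite_voters by blast
      show "\<forall>x. card {a \<in> A. x \<le> a} \<le> card {b \<in> {a \<in> voters n. (n - a) mod 2 = c}. x \<le> b}"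
      proof
        fix x :: nat
        \<comment> \<open>The bound \<open>half\<close> is only available for voters; as these start
          at 1, replacing \<open>x = 0\<close> by 1 changes nothing.\<close>
        let ?y = "max x 1"
        have shift: "{a \<in> A. x \<le> a} = {a \<in> A. ?y \<le> a}"
          using A by (auto simp: voters_def)
        show "card {a \<in> A. x \<le> a} \<le> card {b \<in> {a \<in> voters n. (n - a) mod 2 = c}. x \<le> b}"
        proof (cases "?y \<le> n")
          case True
          then have "card {a \<in> A. ?y \<le> a} \<le> (n + 1 - ?y) div 2"
            by (intro half) (auto simp: voters_def)
          also have "\<dots> \<le> card {a \<in> {?y..n}. (n - a) mod 2 = c}"
            by (rule card_alternating_ge[OF c])
          also have "{a \<in> {?y..n}. (n - a) mod 2 = c} =
              {b \<in> {a \<in> voters n. (n - a) mod 2 = c}. x \<le> b}"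
            by (auto simp: voters_def)
          finally show ?thesis
            by (simp only: shift)
        next
          case False
          then have "{a \<in> A. x \<le> a} = {}"
            unfolding shift using A by (force simp: voters_def)
          then show ?thesis
            by (simp only: card.empty)
        qed
      qed
    qed simp
    have compl: "voters n - {a \<in> voters n. (n - a) mod 2 = 0} = {a \<in> voters n. (n - a) mod 2 = 1}"
      by auto
    have "{a \<in> voters n. (n - a) mod 2 = 0} \<subseteq> voters n"
      "{a \<in> voters n. (n - a) mod 2 = 0} \<in> generated_game n A"
      "voters n - {a \<in> voters n. (n - a) mod 2 = 0} \<in> generated_game n A"
      unfolding compl using dom[of 0] dom[of 1] by (auto simp: generated_game_def)
    then show False
      using proper unfolding proper_game_def by metis
  qed
next
  assume "\<exists>x\<in>voters n. n + 1 - x < 2 * card {a \<in> A. x \<le> a}"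
  then obtain x where x: "x \<in> voters n" "n + 1 - x < 2 * card {a \<in> A. x \<le> a}"
    by blast
  show "proper_game n (generated_game n A)"
    unfolding proper_game_def
  proof
    assume "\<exists>B\<subseteq>voters n. B \<in> generated_game n A \<and> voters n - B \<in> generated_game n A"
    then obtain B where B: "B \<subseteq> voters n" "A \<preceq> B" "A \<preceq> voters n - B"
      by (auto simp: generated_game_def)
    have fin: "finite A" "finite B"
      using A B(1) finite_subset finite_voters by blast+
    have "2 * card {a \<in> A. x \<le> a} \<le> card {b \<in> B. x \<le> b} + card {b \<in> voters n - B. x \<le> b}"
      using B fin shift_le_iff_card_ge[of A B] shift_le_iff_card_ge[of A "voters n - B"]
      by (auto simp: mult_2 intro: add_mono)
    also have "\<dots> = card ({b \<in> B. x \<le> b} \<union> {b \<in> voters n - B. x \<le> b})"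
      using fin by (subst card_Un_disjoint) auto
    also have "{b \<in> B. x \<le> b} \<union> {b \<in> voters n - B. x \<le> b} = {x..n}"
      using B(1) x(1) by (auto simp: voters_def)
    finally show False
      using x(2) by simp
  qed
qed

lemma largest_voters_eq: "largest_voters n m = {i \<in> voters n. n + 1 - m \<le> i}"
proof -
  have "{j \<in> voters n. i < j} = {i<..n}" for i
    by (auto simp: voters_def)
  then show ?thesis
    unfolding largest_voters_def by (auto simp: voters_def)
qed

lemma proper_generated_game_iff_largest_voters:
  assumes A: "A \<subseteq> voters n"
  shows "proper_game n (generated_game n A) \<longleftrightarrow>
           (\<exists>k. 1 \<le> k \<and> k \<le> n \<and> k \<le> card (A \<inter> largest_voters n (2 * k - 1)))"
    (is "_ \<longleftrightarrow> ?R")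
proof -
  have fin: "finite A"
    using A finite_subset finite_voters by blast
  have inter: "A \<inter> largest_voters n m = {a \<in> A. n + 1 - m \<le> a}" for m
    using A by (auto simp: largest_voters_eq)
  have "(\<exists>x\<in>voters n. n + 1 - x < 2 * card {a \<in> A. x \<le> a}) \<longleftrightarrow> ?R"
  proof
    assume "\<exists>x\<in>voters n. n + 1 - x < 2 * card {a \<in> A. x \<le> a}"
    then obtain x where x: "x \<in> voters n" "n + 1 - x < 2 * card {a \<in> A. x \<le> a}"
      by blast
    \<comment> \<open>For a segment of \<open>s\<close> voters, this is the least integer above
      \<open>s / 2\<close>. Then \<open>2 * k - 1\<close> is \<open>s\<close> or
      \<open>s + 1\<close>, so the \<open>2 * k - 1\<close> largest voters include the
      segment.\<close>
    define k where "k = (n + 1 - x) div 2 + 1"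
    have k: "k \<le> card {a \<in> A. x \<le> a}"
      using x(2) by (simp add: k_def)
    also have "\<dots> \<le> card (A \<inter> largest_voters n (2 * k - 1))"
      unfolding inter using fin by (intro card_mono) (auto simp: k_def)
    finally have "k \<le> card (A \<inter> largest_voters n (2 * k - 1))" .
    moreover have "k \<le> n"
    proof -
      have "card {a \<in> A. x \<le> a} \<le> card (voters n)"
        using A by (intro card_mono) auto
      then show ?thesis
        using k by (simp add: voters_def)
    qed
    moreover have "1 \<le> k"
      by (simp add: k_def)
    ultimately show ?R
      by blast
  next
    assume ?R
    then obtain k where k: "1 \<le> k" "k \<le> n" "k \<le> card {a \<in> A. n + 1 - (2 * k - 1) \<le> a}"
      unfolding inter by blast
    \<comment> \<open>When \<open>2 * k - 1 > n\<close> the difference truncates to 0, which is no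
      voter; the segment is then all of \<open>voters n\<close>, of size less than
      \<open>2 * k\<close>.\<close>
    define x where "x = max 1 (n + 1 - (2 * k - 1))"
    have "{a \<in> A. n + 1 - (2 * k - 1) \<le> a} = {a \<in> A. x \<le> a}"
      using A by (auto simp: x_def voters_def)
    then have "n + 1 - x < 2 * card {a \<in> A. x \<le> a}"
      using k by (simp add: x_def)
    moreover have "x \<in> voters n"
      using k by (auto simp: x_def voters_def)
    ultimately show "\<exists>x\<in>voters n. n + 1 - x < 2 * card {a \<in> A. x \<le> a}"
      by blast
  qed
  then show ?thesis
    using proper_generated_game_iff[OF A] by simp
qed

section \<open>Counting ballot sequences\<close>

text \<open>A ballot sequence of length \<open>n\<close>, encoded by its marked positions: in no
  prefix do marks outnumber blanks. Prefixes replace final segments so that induction on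
  \<open>n\<close> appends a last position.\<close>

definition ballot_sets :: "nat \<Rightarrow> nat set set" where
  "ballot_sets n = {A. A \<subseteq> {..<n} \<and> (\<forall>m\<le>n. 2 * card (A \<inter> {..<m}) \<le> m)}"

lemma ballot_sets_card_le: "A \<in> ballot_sets n \<Longrightarrow> 2 * card A \<le> n"
  unfolding ballot_sets_def by (auto dest!: spec[of _ n] simp: Int_absorb2)

lemma finite_ballot_sets [simp]: "finite (ballot_sets n)"
  by (rule finite_subset[of _ "Pow {..<n}"]) (auto simp: ballot_sets_def)

text \<open>Prefixes of length at most \<open>n\<close> do not see position \<open>n\<close>; only
  the full length adds a condition.\<close>

lemma ballot_sets_Suc_iff:
  "A \<in> ballot_sets (Suc n) \<longleftrightarrow> A \<subseteq> {..<Suc n} \<and> A \<inter> {..<n} \<in> ballot_sets n \<and> 2 * card A \<le> Suc n"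
proof -
  have "A \<inter> {..<n} \<inter> {..<m} = A \<inter> {..<m}" if "m \<le> n" for m
    using that by auto
  moreover have "A \<inter> {..<Suc n} = A" if "A \<subseteq> {..<Suc n}"
    using that by auto
  ultimately show ?thesis
    unfolding ballot_sets_def by (auto simp: le_Suc_eq)
qed

text \<open>Deleting the last position gives a Pascal recursion, which the difference of binomials
  satisfies too. The range includes the boundary \<open>2 * k = n + 1\<close>, where both sides
  vanish, because the induction step reaches it.\<close>

lemma card_ballot_sets_card_eq:
  assumes "2 * k \<le> n + 1"
  shows "int (card {A \<in> ballot_sets n. card A = k}) =
           int (n choose k) - (if k = 0 then 0 else int (n choose (k - 1)))"
  using assms
proof (induction n arbitrary: k)
  case 0
  have "{A \<in> ballot_sets 0. card A = 0} = {{}}"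
    by (auto simp: ballot_sets_def)
  moreover have "k = 0"
    using 0 by simp
  ultimately show ?case
    by simp
next
  case (Suc n)
  show ?case
  proof (cases "2 * k = n + 2")
    \<comment> \<open>At the boundary there are too many marks for a ballot set, and the binomials
      agree since \<open>k + (k - 1) = Suc n\<close>.\<close>
    case True
    then have "{A \<in> ballot_sets (Suc n). card A = k} = {}"
      using ballot_sets_card_le by fastforce
    moreover have "Suc n choose k = Suc n choose (k - 1)"
      using True by (subst binomial_symmetric) (auto intro: arg_cong2[of _ _ _ _ "(choose)"])
    ultimately show ?thesis
      using True by simp
  next
    case False
    then have k: "2 * k \<le> n + 1"
      using Suc.prems by simp
    \<comment> \<open>The split is by whether position \<open>n\<close> is marked:
      \<open>S k\<close> has the sets avoiding it, \<open>T\<close> those containing it. The guard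
      in \<open>T\<close> prevents \<open>k - 1\<close> from truncating to 0 and contributing
      \<open>{n}\<close> when \<open>k = 0\<close>.\<close>
    define S where "S j = {A \<in> ballot_sets n. card A = j}" for j
    define T where "T = (if k = 0 then {} else insert n ` S (k - 1))"
    have notin: "n \<notin> A" if "A \<in> ballot_sets n" for A
      using that by (auto simp: ballot_sets_def)
    have fin: "finite A" if "A \<in> ballot_sets n" for A
      using that finite_subset[of A "{..<n}"] by (auto simp: ballot_sets_def)
    have "{A \<in> ballot_sets (Suc n). card A = k} = S k \<union> T"
    proof (intro set_eqI iffI)
      fix A assume "A \<in> {A \<in> ballot_sets (Suc n). card A = k}"
      then have A: "A \<subseteq> {..<Suc n}" "A \<inter> {..<n} \<in> ballot_sets n" "card A = k"
        by (auto simp: ballot_sets_Suc_iff)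
      show "A \<in> S k \<union> T"
      proof (cases "n \<in> A")
        case True
        then have eq: "A = insert n (A \<inter> {..<n})"
          using A(1) by auto
        then have "card A = Suc (card (A \<inter> {..<n}))"
          by (metis A(2) fin notin card_insert_disjoint)
        then have "k \<noteq> 0" "A \<inter> {..<n} \<in> S (k - 1)"
          using A by (auto simp: S_def)
        then show ?thesis
          using eq by (auto simp: T_def)
      next
        case False
        then have "A \<inter> {..<n} = A"
          using A(1) by (auto simp: less_Suc_eq)
        then show ?thesis
          using A by (simp add: S_def)
      qed
    next
      \<comment> \<open>For sets of size \<open>k\<close>, the condition on the full length is just
        \<open>2 * k \<le> n + 1\<close>, so it holds in both cases.\<close>
      fix A assume "A \<in> S k \<union> T"
      then show "A \<in> {A \<in> ballot_sets (Suc n). card A = k}"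
      proof
        assume A: "A \<in> S k"
        then have "A \<subseteq> {..<n}"
          by (auto simp: S_def ballot_sets_def)
        then have "A \<inter> {..<n} = A" "A \<subseteq> {..<Suc n}"
          by auto
        then show ?thesis
          using A k by (auto simp: S_def ballot_sets_Suc_iff)
      next
        assume "A \<in> T"
        then obtain B where B: "k \<noteq> 0" "A = insert n B" "B \<in> ballot_sets n" "card B = k - 1"
          by (auto simp: T_def S_def split: if_splits)
        then have "B \<subseteq> {..<n}"
          by (auto simp: ballot_sets_def)
        then have "A \<inter> {..<n} = B" "A \<subseteq> {..<Suc n}"
          using B(2) by auto
        moreover have "card A = k"
          using B fin notin by simp
        ultimately show ?thesis
          using B(3) k by (auto simp: ballot_sets_Suc_iff)
      qed
    qed
    moreover have "S k \<inter> T = {}"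
      using notin by (auto simp: T_def S_def)
    moreover have "finite (S k)" "finite T"
      by (auto simp: S_def T_def)
    ultimately have "card {A \<in> ballot_sets (Suc n). card A = k} = card (S k) + card T"
      by (simp add: card_Un_disjoint)
    moreover have "card T = (if k = 0 then 0 else card (S (k - 1)))"
    proof -
      have "inj_on (insert n) (S (k - 1))"
        using notin by (intro inj_onI) (metis (no_types, lifting) S_def insert_ident mem_Collect_eq)
      then show ?thesis
        by (simp add: T_def card_image)
    qed
    moreover have "int (card (S k)) = int (n choose k) - (if k = 0 then 0 else int (n choose (k - 1)))"
      using Suc.IH[OF k] by (simp add: S_def)
    moreover have "int (card (S (k - 1))) =
        int (n choose (k - 1)) - (if k - 1 = 0 then 0 else int (n choose (k - 1 - 1)))"
      using Suc.IH[of "k - 1"] k by (simp add: S_def)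
    \<comment> \<open>Pascal's rule is applied to both binomials; \<open>k = 0\<close> and
      \<open>k = 1\<close> are separated because of the guarded terms.\<close>
    ultimately show ?thesis
      by (cases k; cases "k - 1") auto
  qed
qed

lemma card_ballot_sets: "card (ballot_sets n) = n choose (n div 2)"
proof -
  have telescope: "(\<Sum>k\<le>m. int (n choose k) - (if k = 0 then 0 else int (n choose (k - 1))))
      = int (n choose m)" for m
    by (induction m) auto
  have "ballot_sets n = (\<Union>k\<le>n div 2. {A \<in> ballot_sets n. card A = k})"
    using ballot_sets_card_le by fastforce
  also have "card \<dots> = (\<Sum>k\<le>n div 2. card {A \<in> ballot_sets n. card A = k})"
    by (intro card_UN_disjoint) auto
  also have "int \<dots> = (\<Sum>k\<le>n div 2. int (n choose k) - (if k = 0 then 0 else int (n choose (k - 1))))"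
    unfolding of_nat_sum by (intro sum.cong refl card_ballot_sets_card_eq) auto
  finally show ?thesis
    using telescope by simp
qed

section \<open>Counting improper generators and proper games\<close>

text \<open>The reflection \<open>a \<mapsto> n - a\<close> carries final segments of
  \<open>{1..n}\<close> to prefixes of \<open>{..<n}\<close>, hence improper generators bijectively
  to ballot sets.\<close>

lemma card_improper_generators:
  "card {A. A \<subseteq> voters n \<and> \<not> proper_game n (generated_game n A)} = n choose (n div 2)"
proof -
  let ?r = "\<lambda>a. n - a"
  have inj: "inj_on ?r (voters n)"
    by (auto simp: inj_on_def voters_def)
  have img: "?r ` voters n = {..<n}"
  proof
    show "{..<n} \<subseteq> ?r ` voters n"
    proof
      fix i assume "i \<in> {..<n}"
      then show "i \<in> ?r ` voters n"
        by (intro image_eqI[of _ _ "n - i"]) (auto simp: voters_def)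
    qed
  qed (auto simp: voters_def)
  have "A \<subseteq> voters n \<Longrightarrow> \<not> proper_game n (generated_game n A) \<longleftrightarrow> ?r ` A \<in> ballot_sets n" for A
  proof -
    assume A: "A \<subseteq> voters n"
    have seg: "card (?r ` A \<inter> {..<m}) = card {a \<in> A. n + 1 - m \<le> a}" if "m \<le> n" for m
    proof -
      have "?r ` A \<inter> {..<m} = ?r ` {a \<in> A. n + 1 - m \<le> a}"
        using A that by (force simp: voters_def)
      then show ?thesis
        using inj A by (simp add: card_image inj_on_subset[OF inj] subset_iff)
    qed
    have "?r ` A \<in> ballot_sets n \<longleftrightarrow> (\<forall>m\<le>n. 2 * card {a \<in> A. n + 1 - m \<le> a} \<le> m)"
      using img A by (auto simp: ballot_sets_def seg)
    \<comment> \<open>The substitution is \<open>m = n + 1 - x\<close>; the remaining value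
      \<open>m = 0\<close> corresponds to no voter and concerns an empty segment.\<close>
    also have "\<dots> \<longleftrightarrow> (\<forall>x\<in>voters n. 2 * card {a \<in> A. x \<le> a} \<le> n + 1 - x)"
    proof (intro iffI ballI allI impI)
      fix x assume "\<forall>m\<le>n. 2 * card {a \<in> A. n + 1 - m \<le> a} \<le> m" "x \<in> voters n"
      then show "2 * card {a \<in> A. x \<le> a} \<le> n + 1 - x"
        by (auto simp: voters_def dest!: spec[of _ "n + 1 - x"])
    next
      fix m assume h: "\<forall>x\<in>voters n. 2 * card {a \<in> A. x \<le> a} \<le> n + 1 - x" and m: "m \<le> n"
      show "2 * card {a \<in> A. n + 1 - m \<le> a} \<le> m"
      proof (cases "m = 0")
        case True
        then have "{a \<in> A. n + 1 - m \<le> a} = {}"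
          using A by (auto simp: voters_def)
        then show ?thesis
          by (simp only: card.empty)
      next
        case False
        then have "n + 1 - m \<in> voters n" "n + 1 - (n + 1 - m) = m"
          using m by (auto simp: voters_def)
        then show ?thesis
          using h by metis
      qed
    qed
    finally show ?thesis
      using proper_generated_game_iff[OF A] by (auto simp: not_less)
  qed
  then have "image ?r ` {A. A \<subseteq> voters n \<and> \<not> proper_game n (generated_game n A)} =
      image ?r ` {A \<in> Pow (voters n). ?r ` A \<in> ballot_sets n}"
    by (intro arg_cong[of _ _ "image _"]) auto
  also have "\<dots> = ballot_sets n \<inter> image ?r ` Pow (voters n)"
    by auto
  also have "\<dots> = ballot_sets n"
    unfolding image_Pow_surj[OF img] by (auto simp: ballot_sets_def)
  finally have "image ?r ` {A. A \<subseteq> voters n \<and> \<not> proper_game n (generated_game n A)} = ballot_sets n" .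
  then have "bij_betw (image ?r) {A. A \<subseteq> voters n \<and> \<not> proper_game n (generated_game n A)} (ballot_sets n)"
    using inj_on_image_Pow[OF inj] by (auto simp: bij_betw_def intro: inj_on_subset)
  then show ?thesis
    using card_ballot_sets by (simp add: bij_betw_same_card)
qed

theorem theorem3p13:
  fixes n :: nat
  shows "int (card {W. linear_game n W \<and> proper_game n W \<and>
                       (\<exists>!A. A \<in> shift_minimal_winning W)})
           = 2 ^ n - int (n choose (n div 2))
       \<and> (\<forall>A. A \<subseteq> voters n \<longrightarrow>
            (proper_game n (generated_game n A) \<longleftrightarrow>
             (\<exists>k. 1 \<le> k \<and> k \<le> n \<and> k \<le> card (A \<inter> largest_voters n (2 * k - 1)))))"
proof (intro conjI allI impI)
  let ?P = "{A. A \<subseteq> voters n \<and> proper_game n (generated_game n A)}"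
  let ?I = "{A. A \<subseteq> voters n \<and> \<not> proper_game n (generated_game n A)}"
  \<comment> \<open>The empty set has no majority anywhere, so it is already among the improper
    generators. Excluding it from the generators therefore costs nothing, and the count runs over
    all \<open>2 ^ n\<close> subsets.\<close>
  have "{} \<notin> ?P"
    using proper_generated_game_iff[of "{}" n] by simp
  then have "{W. linear_game n W \<and> proper_game n W \<and> (\<exists>!A. A \<in> shift_minimal_winning W)} =
      generated_game n ` ?P"
    by (subst conj_left_commute, subst linear_game_unique_shift_minimal_iff) auto
  then have "card {W. linear_game n W \<and> proper_game n W \<and> (\<exists>!A. A \<in> shift_minimal_winning W)} =
      card ?P"
    by (simp add: card_image inj_on_subset[OF inj_on_generated_game] Collect_mono Pow_def)
  moreover have "card ?P + card ?I = 2 ^ n"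
  proof -
    have "card (Pow (voters n)) = card (?P \<union> ?I)"
      by (intro arg_cong[of _ _ card]) auto
    also have "\<dots> = card ?P + card ?I"
      by (intro card_Un_disjoint) auto
    finally show ?thesis
      by (simp add: card_Pow voters_def)
  qed
  ultimately show "int (card {W. linear_game n W \<and> proper_game n W \<and>
      (\<exists>!A. A \<in> shift_minimal_winning W)}) = 2 ^ n - int (n choose (n div 2))"
    using card_improper_generators[of n] by (simp add: eq_diff_eq flip: of_nat_add)
next
  show "proper_game n (generated_game n A) \<longleftrightarrow>
      (\<exists>k. 1 \<le> k \<and> k \<le> n \<and> k \<le> card (A \<inter> largest_voters n (2 * k - 1)))"
    if "A \<subseteq> voters n" for A
    using that by (rule proper_generated_game_iff_largest_voters)
qed

end
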